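(* Let $S$ be a finite set with $|S|=N\ge 2$, and let $\#(N)$ be the number of families $\mathcal{B}\subseteq\mathcal{P}(S)$ that are topological bases on $S$. Then $$2^{2^N-N}\;\le\;\#(N)\;\le\;2^{2^N-N}+2^{N(N-1)+3\cdot 2^{N-2}}.$$
   Context: A family $\mathcal{B}\subseteq\mathcal{P}(S)$ is a topological basis on $S$ if (1) $\bigcup_{B\in\mathcal{B}}B=S$, and (2) for all $B_1,B_2\in\mathcal{B}$ and all $x\in B_1\cap B_2$ there is $B_3\in\mathcal{B}$ with $x\in B_3\subseteq B_1\cap B_2$. The empty set is allowed, but not required, to be a member of $\mathcal{B}$. *)

theory Defs
  imports Main
begin

definition topological_basis_on :: "'a set \<Rightarrow> 'a set set \<Rightarrow> bool" where
  "topological_basis_on S \<B> \<longleftrightarrow>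
     \<B> \<subseteq> Pow S \<and>
     \<Union>\<B> = S \<and>
     (\<forall>B1\<in>\<B>. \<forall>B2\<in>\<B>. \<forall>x\<in>B1 \<inter> B2. \<exists>B3\<in>\<B>. x \<in> B3 \<and> B3 \<subseteq> B1 \<inter> B2)"

definition num_topological_bases :: "'a set \<Rightarrow> nat" where
  "num_topological_bases S = card {\<B>. topological_basis_on S \<B>}"

end

(*
  If every ordered pair x \<noteq> y of points is separated by a member of the basis containing x but
  not y, then intersecting such members shows that every singleton is a member; conversely every
  family containing all singletons is a basis. There are 2^(2^N - N) such families. Any other basis
  lies, for one of the N(N - 1) \<le> 2^(N(N - 1)) pairs x \<noteq> y, in the collection of the 3 * 2^(N - 2)
  subsets A with x \<in> A \<longrightarrow> y \<in> A, and the union bound applies.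
*)
theory Submission
  imports Defs
begin

text \<open>Such a \<open>C\<close> is determined by \<open>C - A\<close>, an arbitrary subset of
  \<open>B - A\<close>. The lemma serves on two levels: for sets of points that contain
  \<open>x\<close> and avoid \<open>y\<close>, and for families that contain all singletons.\<close>

lemma card_supersets_between:
  assumes "finite B" "A \<subseteq> B"
  shows "card {C. A \<subseteq> C \<and> C \<subseteq> B} = 2 ^ (card B - card A)"
proof -
  have "bij_betw (\<lambda>C. C \<union> A) (Pow (B - A)) {C. A \<subseteq> C \<and> C \<subseteq> B}"
    by (rule bij_betw_byWitness[where f' = "\<lambda>C. C - A"]) (use assms(2) in auto)
  then have "card {C. A \<subseteq> C \<and> C \<subseteq> B} = card (Pow (B - A))"
    by (metis bij_betw_same_card)
  also have "\<dots> = 2 ^ (card B - card A)"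
    using assms by (simp add: card_Pow card_Diff_subset finite_subset)
  finally show ?thesis .
qed

text \<open>The sets violating the implication contain \<open>x\<close> and omit \<open>y\<close>.
  They make up a quarter of all subsets, so three quarters remain.\<close>

lemma card_subsets_implied_membership:
  assumes "finite S" "x \<in> S" "y \<in> S" "x \<noteq> y"
  shows "card {A \<in> Pow S. x \<in> A \<longrightarrow> y \<in> A} = 3 * 2 ^ (card S - 2)"
proof -
  let ?D = "{A. {x} \<subseteq> A \<and> A \<subseteq> S - {y}}"
  have eq: "{A \<in> Pow S. x \<in> A \<longrightarrow> y \<in> A} = Pow S - ?D"
    by auto
  have "card ?D = 2 ^ (card (S - {y}) - card {x})"
    by (rule card_supersets_between) (use assms in auto)
  then have D: "card ?D = 2 ^ (card S - 2)"
    using assms by (simp add: numeral_2_eq_2)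
  \<comment> \<open>Two distinct points force \<open>card S \<ge> 2\<close>, so the truncated
    subtraction in \<open>card S - 2\<close> loses nothing.\<close>
  have "card {x, y} \<le> card S"
    using assms by (intro card_mono) auto
  then have "2 + (card S - 2) = card S"
    using assms by simp
  then have "2 ^ card S = (4::nat) * 2 ^ (card S - 2)"
    by (metis power_add mult_2 numeral_Bit0 power2_eq_square)
  moreover have "card (Pow S - ?D) = card (Pow S) - card ?D"
    using assms(1) by (intro card_Diff_subset) (auto intro: finite_subset[of _ "Pow S"])
  ultimately show ?thesis
    unfolding eq D using assms(1) by (simp only: card_Pow)
qed

lemma topological_basis_on_if_singletons:
  assumes "\<B> \<subseteq> Pow S" "\<And>x. x \<in> S \<Longrightarrow> {x} \<in> \<B>"
  shows "topological_basis_on S \<B>"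
  unfolding topological_basis_on_def
proof (intro conjI ballI)
  show "\<Union>\<B> = S"
    using assms by blast
  show "\<exists>B3\<in>\<B>. x \<in> B3 \<and> B3 \<subseteq> B1 \<inter> B2" if "B1 \<in> \<B>" "B2 \<in> \<B>" "x \<in> B1 \<inter> B2" for B1 B2 x
    using that assms by (intro bexI[of _ "{x}"]) auto
qed (fact assms(1))

text \<open>A basis need not be closed under intersection, so separating members are not simply
  intersected. Instead the second basis axiom supplies a smaller member around \<open>x\<close>
  inside each pairwise intersection, and since \<open>S\<close> is finite, the other points can be
  excluded one at a time.\<close>

lemma singleton_in_separating_basis:
  assumes basis: "topological_basis_on S \<B>" and "finite S" "x \<in> S"
    and sep: "\<And>y. y \<in> S \<Longrightarrow> y \<noteq> x \<Longrightarrow> \<exists>B\<in>\<B>. x \<in> B \<and> y \<notin> B"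
  shows "{x} \<in> \<B>"
proof -
  \<comment> \<open>\<open>F\<close> collects the points excluded so far. The empty case is the
    covering axiom at \<open>x\<close>; the final choice is \<open>F = S - {x}\<close>.\<close>
  have "\<exists>B\<in>\<B>. x \<in> B \<and> B \<inter> F = {}" if "finite F" "F \<subseteq> S - {x}" for F
    using that
  proof (induction F rule: finite_induct)
    case empty
    then show ?case
      using basis \<open>x \<in> S\<close> by (auto simp: topological_basis_on_def)
  next
    case (insert y F)
    then obtain B1 B2 where "B1 \<in> \<B>" "x \<in> B1" "B1 \<inter> F = {}" "B2 \<in> \<B>" "x \<in> B2" "y \<notin> B2"
      using sep[of y] by auto
    moreover from this obtain B3 where "B3 \<in> \<B>" "x \<in> B3" "B3 \<subseteq> B1 \<inter> B2"
      using basis unfolding topological_basis_on_def by blast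
    ultimately show ?case
      by blast
  qed
  from this[of "S - {x}"] obtain B where B: "B \<in> \<B>" "x \<in> B" "B \<inter> (S - {x}) = {}"
    using \<open>finite S\<close> by auto
  moreover have "B \<subseteq> S"
    using basis B(1) by (auto simp: topological_basis_on_def)
  ultimately have "B = {x}"
    by blast
  with B(1) show ?thesis
    by simp
qed

theorem mainTheorem4:
  fixes S :: "'a set" and N :: nat
  assumes "finite S" and "card S = N" and "N \<ge> 2"
  shows "2 ^ (2 ^ N - N) \<le> num_topological_bases S
       \<and> num_topological_bases S \<le> 2 ^ (2 ^ N - N) + 2 ^ (N * (N - 1) + 3 * 2 ^ (N - 2))"
proof -
  let ?bases = "{\<B>. topological_basis_on S \<B>}"
  let ?sing = "(\<lambda>x. {x}) ` S"
  \<comment> \<open>These are the bases of the discrete topology.\<close>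
  let ?disc = "{\<B>. ?sing \<subseteq> \<B> \<and> \<B> \<subseteq> Pow S}"
  let ?pairs = "SIGMA x:S. S - {x}"
  \<comment> \<open>All families without a member separating \<open>x\<close> from \<open>y\<close>,
    whether bases or not. This overcounts, but a full power set is easy to count.\<close>
  let ?impl = "\<lambda>(x, y). Pow {A \<in> Pow S. x \<in> A \<longrightarrow> y \<in> A}"
  have fin: "finite (Pow (Pow S))"
    using assms(1) by simp
  have bases_Pow: "?bases \<subseteq> Pow (Pow S)"
    by (auto simp: topological_basis_on_def)
  have "card ?disc = 2 ^ (card (Pow S) - card ?sing)"
    by (rule card_supersets_between) (use assms(1) in auto)
  then have disc: "card ?disc = 2 ^ (2 ^ N - N)"
    using assms by (simp add: card_Pow card_image)
  have "?disc \<subseteq> ?bases"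
    by (auto intro!: topological_basis_on_if_singletons)
  then have "card ?disc \<le> card ?bases"
    using bases_Pow fin by (intro card_mono) (auto intro: finite_subset)
  then have lower: "2 ^ (2 ^ N - N) \<le> num_topological_bases S"
    by (simp add: disc num_topological_bases_def)

  have cover: "?bases \<subseteq> ?disc \<union> \<Union> (?impl ` ?pairs)"
  proof
    fix \<B> assume "\<B> \<in> ?bases"
    then have basis: "topological_basis_on S \<B>" and Pow: "\<B> \<subseteq> Pow S"
      by (auto simp: topological_basis_on_def)
    show "\<B> \<in> ?disc \<union> \<Union> (?impl ` ?pairs)"
    proof (cases "\<exists>(x, y)\<in>?pairs. \<forall>B\<in>\<B>. x \<in> B \<longrightarrow> y \<in> B")
      case True
      then obtain x y where "(x, y) \<in> ?pairs" "\<forall>B\<in>\<B>. x \<in> B \<longrightarrow> y \<in> B"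
        by blast
      then show ?thesis
        using Pow by (intro UnI2 UN_I[of "(x, y)"]) auto
    next
      \<comment> \<open>Now each \<open>y \<noteq> x\<close> in \<open>S\<close> is missed by some
        member containing \<open>x\<close>, which is the separation hypothesis at every
        point.\<close>
      case False
      have "{x} \<in> \<B>" if "x \<in> S" for x
        by (rule singleton_in_separating_basis[OF basis assms(1) that]) (use False that in auto)
      then show ?thesis
        using Pow by auto
    qed
  qed
  have impl: "card (?impl p) = 2 ^ (3 * 2 ^ (N - 2))" if "p \<in> ?pairs" for p
  proof -
    obtain x y where p: "p = (x, y)" "x \<in> S" "y \<in> S" "x \<noteq> y"
      using \<open>p \<in> ?pairs\<close> by auto
    then have "card {A \<in> Pow S. x \<in> A \<longrightarrow> y \<in> A} = 3 * 2 ^ (N - 2)"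
      using card_subsets_implied_membership[of S x y] assms by simp
    then show ?thesis
      using assms(1) by (simp add: p(1) card_Pow)
  qed
  have pairs: "finite ?pairs" "card ?pairs = N * (N - 1)"
    using assms by (auto simp: card_SigmaI)
  have "card (\<Union> (?impl ` ?pairs)) \<le> (\<Sum>p\<in>?pairs. card (?impl p))"
    by (rule card_UN_le[OF pairs(1)])
  also have "\<dots> = N * (N - 1) * 2 ^ (3 * 2 ^ (N - 2))"
    by (simp only: impl pairs(2) sum_constant of_nat_id cong: sum.cong)
  \<comment> \<open>The crude bound \<open>n < 2 ^ n\<close> on the number of pairs turns the
    product into a single power of two.\<close>
  also have "\<dots> \<le> 2 ^ (N * (N - 1)) * 2 ^ (3 * 2 ^ (N - 2))"
    by (intro mult_right_mono less_imp_le less_exp) auto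
  finally have union: "card (\<Union> (?impl ` ?pairs)) \<le> 2 ^ (N * (N - 1) + 3 * 2 ^ (N - 2))"
    by (simp add: power_add)
  have "card ?bases \<le> card (?disc \<union> \<Union> (?impl ` ?pairs))"
    by (rule card_mono[OF finite_subset[OF _ fin] cover]) auto
  also have "\<dots> \<le> card ?disc + card (\<Union> (?impl ` ?pairs))"
    by (rule card_Un_le)
  finally show ?thesis
    using lower union by (simp add: disc num_topological_bases_def)
qed

end
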